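(* Let $a,b,c$ be positive integers with $c\ge 2$ and $\gcd(b,c)=1$. For every integer $l$ with $1\le l\le c-1$ there exists a unique $a$-reduced set of integers $\{j_i^{(l)}\}_{i=1}^{k_l}$, for some positive integer $k_l$, such that $$l=\sum_{i=1}^{k_l}j_i^{(l)}\cdot s_i(a).$$ Moreover, define $x_0:=0$ and $x_l:=\sum_{i=1}^{k_l}j_i^{(l)}\cdot t_i(a,b,c)$ for $1\le l\le c-1$. Then the following hold: (1) for every integer $l$ with $0\le l\le c-1$, $x_l=\min\{x\in G_{a,b}(c): x\equiv bl \pmod c\}$; (2) $\operatorname{Ap}(G_{a,b}(c),c)=\{x_l: 0\le l\le c-1\}$; (3) $F(G_{a,b}(c))=x_{c-1}-c$; (4) $g(G_{a,b}(c))=\frac{1}{c}\cdot\sum_{l=1}^{c-1}x_l-\frac{c-1}{2}$.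
   Context: $\mathbb{N}$ denotes the set of non-negative integers (including $0$). For positive integers $a,b$ let $\theta_{a,b}:\mathbb{N}\to\mathbb{N}$, $x\mapsto ax+b$. A subsemigroup $G$ of $(\mathbb{N},+)$ containing $0$ is called a $\theta_{a,b}$-semigroup if $\theta_{a,b}(y)\in G$ for every $y\in G\setminus\{0\}$. $G_{a,b}(c)$ denotes the smallest (with respect to inclusion) $\theta_{a,b}$-semigroup containing $c$; under the stated hypotheses it is a numerical semigroup, i.e. a subsemigroup of $(\mathbb{N},+)$ containing $0$ with finite complement in $\mathbb{N}$. For $k\in\mathbb{N}$ set $s_0(a)=0$ and $s_k(a)=\sum_{i=0}^{k-1}a^i$ for $k\ge 1$, and $t_k(a,b,c)=a^kc+b\cdot s_k(a)$. A family $\{j_i\}_{i=1}^{k}$ of non-negative integers ($k\ge 1$) is called $a$-reduced if: $0\le j_i\le a$ for all $1\le i\le k$; $j_k\ne 0$; and whenever $j_m=a$ for some $1\le m\le k$, then $j_i=0$ for all $1\le i<m$. Two such families are equal if they have the same index set and the same entries. For a numerical semigroup $G$: $g(G)=|\mathbb{N}\setminus G|$ is the genus; $F(G)=\max\{x: x\in\mathbb{Z}\setminus G\}$ is the Frobenius number; and for $n\in G\setminus\{0\}$, $\operatorname{Ap}(G,n)=\{s\in G: s-n\notin G\}$ is the Apéry set. *)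

theory Defs
  imports Complex_Main "HOL-Number_Theory.Cong"
begin

definition subsemigroup0 :: "nat set \<Rightarrow> bool" where
  "subsemigroup0 G \<longleftrightarrow> 0 \<in> G \<and> (\<forall>x\<in>G. \<forall>y\<in>G. x + y \<in> G)"

definition numerical_semigroup :: "nat set \<Rightarrow> bool" where
  "numerical_semigroup G \<longleftrightarrow> subsemigroup0 G \<and> finite (- G)"

definition theta :: "nat \<Rightarrow> nat \<Rightarrow> nat \<Rightarrow> nat" where
  "theta a b x = a * x + b"

definition theta_semigroup :: "nat \<Rightarrow> nat \<Rightarrow> nat set \<Rightarrow> bool" where
  "theta_semigroup a b G \<longleftrightarrow> subsemigroup0 G \<and> (\<forall>y\<in>G - {0}. theta a b y \<in> G)"

text \<open>The semigroup \<open>G\<^sub>a\<^sub>,\<^sub>b(c)\<close>, as the intersection of all \<open>\<theta>\<^sub>a\<^sub>,\<^sub>b\<close>-semigroups containing \<open>c\<close>.\<close>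

definition theta_gen :: "nat \<Rightarrow> nat \<Rightarrow> nat \<Rightarrow> nat set" where
  "theta_gen a b c = theta_semigroup a b hull {c}"

lemma theta_gen_least:
  "theta_semigroup a b (theta_gen a b c)"
  "c \<in> theta_gen a b c"
  "theta_semigroup a b H \<Longrightarrow> c \<in> H \<Longrightarrow> theta_gen a b c \<subseteq> H"
  unfolding theta_gen_def hull_def theta_semigroup_def subsemigroup0_def by auto

lemma numerical_semigroup_theta_gen:
  assumes "a > 0" "b > 0" "c > 0" "coprime b c"
  shows "numerical_semigroup (theta_gen a b c)"
proof -
  let ?G = "theta_gen a b c" and ?d = "a * c + b"
  have sg: "0 \<in> ?G" "\<And>u v. u \<in> ?G \<Longrightarrow> v \<in> ?G \<Longrightarrow> u + v \<in> ?G"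
    and th: "\<And>y. y \<in> ?G \<Longrightarrow> y \<noteq> 0 \<Longrightarrow> theta a b y \<in> ?G"
    using theta_gen_least(1)[of a b c]
    unfolding theta_semigroup_def subsemigroup0_def by auto
  have mult: "k * u \<in> ?G" if "u \<in> ?G" for k u
    by (induction k) (use sg that in auto)
  have c: "c \<in> ?G" by (rule theta_gen_least(2))
  have d: "?d \<in> ?G" using th[OF c] assms by (simp add: theta_def)
  have cop: "coprime ?d c"
    using assms by (metis coprime_iff_gcd_eq_1 gcd.commute gcd_add_mult add.commute)
  have "n \<in> ?G" if n: "n \<ge> c * ?d" for n
  proof -
    obtain w where w: "[?d * w = 1] (mod c)"
      using cong_solve_coprime_nat[OF cop] by auto
    define k where "k = (w * n) mod c"
    have "[?d * k = ?d * w * n] (mod c)"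
      by (simp add: k_def cong_def mod_mult_right_eq mult.assoc)
    also have "[?d * w * n = 1 * n] (mod c)" using w by (rule cong_mult) simp
    finally have kn: "[n = k * ?d] (mod c)" by (simp add: cong_sym mult.commute)
    have "k \<le> c" using assms by (simp add: k_def less_imp_le)
    hence "k * ?d \<le> n" using n mult_le_mono1 le_trans by blast
    then obtain q where "n = k * ?d + q * c"
      using kn by (metis cong_le_nat add.commute)
    thus ?thesis using sg mult c d by simp
  qed
  hence "- ?G \<subseteq> {..<c * ?d}" using not_less by blast
  hence "finite (- ?G)" by (rule finite_subset) simp
  thus ?thesis
    using theta_gen_least(1) unfolding numerical_semigroup_def theta_semigroup_def by blast
qed

definition s_sum :: "nat \<Rightarrow> nat \<Rightarrow> nat" where
  "s_sum k a = (\<Sum>i<k. a ^ i)"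

definition t_term :: "nat \<Rightarrow> nat \<Rightarrow> nat \<Rightarrow> nat \<Rightarrow> nat" where
  "t_term k a b c = a ^ k * c + b * s_sum k a"

text \<open>A family \<open>j\<^sub>1, \<dots>, j\<^sub>k\<close> is the list \<open>js\<close> of length \<open>k\<close> with \<open>j\<^sub>i = js ! (i - 1)\<close>, so that
  equality of lists is equality of families.\<close>

definition a_reduced :: "nat \<Rightarrow> nat list \<Rightarrow> bool" where
  "a_reduced a js \<longleftrightarrow>
     length js \<ge> 1 \<and>
     (\<forall>i\<in>{1..length js}. js ! (i - 1) \<le> a) \<and>
     js ! (length js - 1) \<noteq> 0 \<and>
     (\<forall>m\<in>{1..length js}. js ! (m - 1) = a \<longrightarrow> (\<forall>i\<in>{1..<m}. js ! (i - 1) = 0))"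

definition represents :: "nat \<Rightarrow> nat list \<Rightarrow> nat \<Rightarrow> bool" where
  "represents a js l \<longleftrightarrow> l = (\<Sum>i = 1..length js. js ! (i - 1) * s_sum i a)"

definition reduced_family :: "nat \<Rightarrow> nat \<Rightarrow> nat list" where
  "reduced_family a l = (THE js. a_reduced a js \<and> represents a js l)"

definition x_elem :: "nat \<Rightarrow> nat \<Rightarrow> nat \<Rightarrow> nat \<Rightarrow> nat" where
  "x_elem a b c l = (if l = 0 then 0
     else (let js = reduced_family a l in \<Sum>i = 1..length js. js ! (i - 1) * t_term i a b c))"

definition genus :: "nat set \<Rightarrow> nat" where
  "genus G = card (- G)"

text \<open>The maximum ranges over all integers outside \<open>G\<close>, negative ones included.\<close>

definition frobenius :: "nat set \<Rightarrow> int" where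
  "frobenius G = (GREATEST z. z \<notin> int ` G)"

lemma frobenius_is_maximum:
  assumes "numerical_semigroup G"
  shows "frobenius G \<notin> int ` G" "z \<notin> int ` G \<Longrightarrow> z \<le> frobenius G"
proof -
  define A where "A = insert (-1) (int ` (- G))"
  have fin: "finite A" using assms unfolding A_def numerical_semigroup_def by simp
  have "Max A \<in> A" using fin by (rule Max_in) (simp add: A_def)
  hence notin: "Max A \<notin> int ` G" by (auto simp: A_def)
  have up: "z \<le> Max A" if "z \<notin> int ` G" for z
  proof (cases "z < 0")
    case True
    have "-1 \<le> Max A" using fin by (rule Max_ge) (simp add: A_def)
    thus ?thesis using True by linarith
  next
    case False
    hence "z = int (nat z)" by simp
    hence "z \<in> A" using that unfolding A_def by (metis ComplI imageI insertI2)
    thus ?thesis using fin by simp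
  qed
  have "frobenius G = Max A"
    unfolding frobenius_def using notin up by (rule Greatest_equality)
  thus "frobenius G \<notin> int ` G" "z \<notin> int ` G \<Longrightarrow> z \<le> frobenius G"
    using notin up by auto
qed

text \<open>The difference is taken in the integers; it is not truncated.\<close>

definition apery :: "nat set \<Rightarrow> nat \<Rightarrow> nat set" where
  "apery G n = {u \<in> G. int u - int n \<notin> int ` G}"

end

theory Submission
  imports Defs
begin

text \<open>Write \<open>D = (a - 1) c + b\<close>. Since \<open>a\<^sup>k = (a - 1) s\<^sub>k + 1\<close>, the generators of the semigroup are
  \<open>t\<^sub>k = c + s\<^sub>k D\<close>, so \<open>G\<^sub>a\<^sub>,\<^sub>b(c)\<close> consists of the numbers \<open>N c + S D\<close> where \<open>S\<close> is a sum of
  exactly \<open>N\<close> of the repunits \<open>s\<^sub>0 = 0, s\<^sub>1, s\<^sub>2, \<dots>\<close> (\<open>theta_gen_eq\<close>). Such an element is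
  congruent to \<open>b S\<close> modulo \<open>c\<close>, so everything depends on the least number \<open>w(S)\<close> of
  repunits with sum \<open>S\<close>.

  The recurrence \<open>s\<^sub>i\<^sub>+\<^sub>1 = a s\<^sub>i + 1\<close> gives \<open>w(S - 1) \<le> w(S) + (a - 1)\<close>
  (\<open>repunit_sum_pred\<close>): in a sum equal to \<open>S\<close>, replace one \<open>s\<^sub>i\<^sub>+\<^sub>1\<close> by \<open>a\<close> copies of \<open>s\<^sub>i\<close>. This
  inequality is used three times. It shows that subtracting the largest possible repunit at each
  step is optimal (\<open>repunit_sum_greedy\<close>). The \<open>a\<close>-reduced families are exactly the outcomes of that
  procedure, because a reduced family of length \<open>k\<close> has a value in \<open>{s\<^sub>k..<s\<^sub>k\<^sub>+\<^sub>1}\<close>; hence they exist,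
  are unique, and have \<open>w(l)\<close> terms, so that \<open>x\<^sub>l = w(l) c + l D\<close>. It shows that \<open>x\<^sub>l\<close> is the least
  element of \<open>G\<^sub>a\<^sub>,\<^sub>b(c)\<close> in the class of \<open>b l\<close> (\<open>mem_theta_gen_iff\<close>): lowering \<open>S = l + q c\<close> to \<open>l\<close>
  costs at most \<open>q c (a - 1)\<close> repunits and saves \<open>q c D\<close>. Finally it shows that \<open>x\<^sub>l\<close> increases
  with \<open>l\<close>. The Apery set, the Frobenius number and the genus are then read off from the least
  elements of the residue classes, the last one by counting the gaps in each class.\<close>

section \<open>Repunits\<close>

lemma s_sum_0 [simp]: "s_sum 0 a = 0"
  by (simp add: s_sum_def)

lemma s_sum_Suc: "s_sum (Suc k) a = a * s_sum k a + 1"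
proof -
  have "s_sum (Suc k) a = a ^ 0 + (\<Sum>i<k. a ^ Suc i)"
    unfolding s_sum_def by (subst sum.lessThan_Suc_shift) simp
  then show ?thesis by (simp add: s_sum_def sum_distrib_left)
qed

lemma s_sum_strict_mono:
  assumes "a > 0"
  shows "strict_mono (\<lambda>k. s_sum k a)"
  unfolding strict_mono_Suc_iff using assms by (simp add: s_sum_def)

lemma t_term_eq:
  assumes "a > 0"
  shows "t_term k a b c = c + s_sum k a * ((a - 1) * c + b)"
proof -
  have "a ^ k = (a - 1) * s_sum k a + 1"
  proof (induction k)
    case (Suc k)
    obtain d where "a = Suc d" using assms gr0_implies_Suc by blast
    then show ?case using Suc by (simp add: s_sum_Suc algebra_simps)
  qed simp
  then show ?thesis by (simp add: t_term_def algebra_simps)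
qed

section \<open>Sums of a prescribed number of repunits\<close>

text \<open>\<open>repunit_sum a k N S\<close>: the number \<open>S\<close> is a sum of exactly \<open>N\<close> terms \<open>s\<^sub>i(a)\<close> with
  \<open>0 \<le> i \<le> k\<close>. Since \<open>s\<^sub>0(a) = 0\<close> is admitted, \<open>N\<close> may always be increased.\<close>

inductive repunit_sum :: "nat \<Rightarrow> nat \<Rightarrow> nat \<Rightarrow> nat \<Rightarrow> bool" for a k where
  zero: "repunit_sum a k 0 0"
| add: "repunit_sum a k N S \<Longrightarrow> i \<le> k \<Longrightarrow> repunit_sum a k (Suc N) (S + s_sum i a)"

lemma repunit_sum_mono: "repunit_sum a k N S \<Longrightarrow> k \<le> k' \<Longrightarrow> repunit_sum a k' N S"
  by (induction rule: repunit_sum.induct) (auto intro: repunit_sum.intros)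

lemma repunit_sum_add:
  "repunit_sum a k M R \<Longrightarrow> repunit_sum a k N S \<Longrightarrow> repunit_sum a k (N + M) (S + R)"
proof (induction rule: repunit_sum.induct)
  case (add M R i)
  then show ?case using repunit_sum.add[of a k "N + M" "S + R" i] by (simp add: add.assoc)
qed simp

lemma repunit_sum_single: "i \<le> k \<Longrightarrow> repunit_sum a k 1 (s_sum i a)"
  using repunit_sum.add[OF repunit_sum.zero] by simp

lemma repunit_sum_mult: "repunit_sum a k N S \<Longrightarrow> repunit_sum a k (n * N) (n * S)"
  by (induction n) (auto intro: repunit_sum.zero repunit_sum_add simp: add.commute)

lemma repunit_sum_pad: "repunit_sum a k N S \<Longrightarrow> N \<le> N' \<Longrightarrow> repunit_sum a k N' S"
  using repunit_sum_add[OF repunit_sum_mult[OF repunit_sum_single[of 0 k a], of "N' - N"], of N S]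
  by simp

lemma repunit_sum_0_eq: "repunit_sum a 0 N S \<Longrightarrow> S = 0"
  by (induction rule: repunit_sum.induct) auto

text \<open>Because \<open>s\<^sub>i\<^sub>+\<^sub>1 - 1 = a s\<^sub>i\<close>, subtracting 1 costs at most \<open>a - 1\<close> additional terms.\<close>

lemma repunit_sum_pred:
  assumes "repunit_sum a k N S" "S > 0" "a > 0"
  shows "repunit_sum a k (N + (a - 1)) (S - 1)"
  using assms
proof (induction rule: repunit_sum.induct)
  case (add N S i)
  show ?case
  proof (cases i)
    case 0
    then have "repunit_sum a k (N + (a - 1)) (S - 1)" using add by simp
    then show ?thesis using 0 repunit_sum_pad by (auto simp: eval_nat_numeral)
  next
    case (Suc i')
    have "repunit_sum a k (N + a * 1) (S + a * s_sum i' a)"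
      using add(1,2) Suc by (intro repunit_sum_add repunit_sum_mult repunit_sum_single) auto
    then show ?thesis using Suc \<open>a > 0\<close> by (simp add: s_sum_Suc)
  qed
qed simp

lemma repunit_sum_diff:
  assumes "repunit_sum a k N (S + m)" "a > 0"
  shows "repunit_sum a k (N + m * (a - 1)) S"
  using assms
proof (induction m arbitrary: N)
  case (Suc m)
  then have "repunit_sum a k (N + (a - 1)) (S + m)"
    using repunit_sum_pred[of a k N "S + Suc m"] by simp
  from Suc.IH[OF this Suc.prems(2)] show ?case by (simp add: add.assoc)
qed simp

lemma repunit_sum_bound_index:
  assumes "repunit_sum a k N S" "S < s_sum (Suc n) a" "a > 0"
  shows "repunit_sum a n N S"
  using assms
proof (induction rule: repunit_sum.induct)
  case (add N S i)
  then have "s_sum i a < s_sum (Suc n) a" by simp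
  then have "i \<le> n" using strict_mono_less[OF s_sum_strict_mono[OF \<open>a > 0\<close>]] by simp
  then show ?case using add by (auto intro: repunit_sum.add)
qed (rule repunit_sum.zero)

lemma repunit_sum_Suc_cases:
  assumes "repunit_sum a (Suc k) N S"
  shows "repunit_sum a k N S \<or>
    (\<exists>M R. N = Suc M \<and> S = R + s_sum (Suc k) a \<and> repunit_sum a (Suc k) M R)"
  using assms
proof (induction rule: repunit_sum.induct)
  case (add N S i)
  show ?case
  proof (cases "i = Suc k")
    case True
    then show ?thesis using add by blast
  next
    case False
    then have "i \<le> k" using add by simp
    from add.IH show ?thesis
    proof
      assume "repunit_sum a k N S"
      then show ?thesis using \<open>i \<le> k\<close> by (auto intro: repunit_sum.add)
    next
      assume "\<exists>M R. N = Suc M \<and> S = R + s_sum (Suc k) a \<and> repunit_sum a (Suc k) M R"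
      then obtain M R where "N = Suc M" "S = R + s_sum (Suc k) a" "repunit_sum a (Suc k) M R"
        by blast
      then have "repunit_sum a (Suc k) N (R + s_sum i a)"
        using repunit_sum.add[of a "Suc k" M R i] \<open>i \<le> k\<close> by simp
      then show ?thesis using \<open>S = _\<close> by (auto simp: algebra_simps)
    qed
  qed
qed (simp add: repunit_sum.zero)

text \<open>The greedy step is optimal: a positive sum of \<open>N\<close> terms of index at most \<open>k\<close> that is at
  least \<open>s\<^sub>k\<close> can be written with \<open>N\<close> such terms one of which is \<open>s\<^sub>k\<close>. In the step from \<open>k\<close>
  to \<open>k + 1\<close>, if \<open>s\<^sub>k\<^sub>+\<^sub>1\<close> does not occur already, then \<open>a\<close> greedy steps remove \<open>a\<close> copies of
  \<open>s\<^sub>k\<close>, and subtracting 1 from the rest, which costs \<open>a - 1\<close> additional terms, amounts to having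
  removed \<open>s\<^sub>k\<^sub>+\<^sub>1 = a s\<^sub>k + 1\<close> for a single term.\<close>

lemma repunit_sum_greedy:
  assumes "a > 0" "repunit_sum a k N (S + s_sum k a)" "S + s_sum k a > 0"
  shows "N > 0 \<and> repunit_sum a k (N - 1) S"
  using assms(2,3)
proof (induction k arbitrary: N S)
  case 0
  then show ?case using repunit_sum_0_eq by fastforce
next
  case (Suc k)
  have greedy: "N > 0 \<and> repunit_sum a k (N - 1) T"
    if "repunit_sum a k N (T + s_sum k a)" "T > 0" for N T
    using Suc.IH[OF that(1)] that(2) by simp
  have iter: "m \<le> N \<and> repunit_sum a k (N - m) T"
    if "repunit_sum a k N (T + m * s_sum k a)" "T > 0" for m N T
    using that
  proof (induction m arbitrary: N)
    case (Suc m)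
    then have "N > 0 \<and> repunit_sum a k (N - 1) (T + m * s_sum k a)"
      by (intro greedy) (auto simp: algebra_simps)
    with Suc.IH[of "N - 1"] Suc.prems show ?case by auto
  qed simp
  from repunit_sum_Suc_cases[OF Suc.prems(1)] show ?case
  proof
    assume "repunit_sum a k N (S + s_sum (Suc k) a)"
    then have "repunit_sum a k N ((S + 1) + a * s_sum k a)" by (simp add: s_sum_Suc)
    from iter[OF this] have le: "a \<le> N" and r: "repunit_sum a k (N - a) (S + 1)" by auto
    from repunit_sum_pred[OF r] le \<open>a > 0\<close> have "repunit_sum a k (N - 1) S" by simp
    then show ?case using le \<open>a > 0\<close> repunit_sum_mono by fastforce
  qed auto
qed

lemma repunit_sum_greedy_iter:
  assumes "a > 0" "k > 0" "repunit_sum a k N (S + m * s_sum k a)"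
  shows "m \<le> N \<and> repunit_sum a k (N - m) S"
  using assms(3)
proof (induction m arbitrary: N)
  case (Suc m)
  have "s_sum k a > 0"
    using strict_mono_less[OF s_sum_strict_mono[OF \<open>a > 0\<close>], of 0 k] \<open>k > 0\<close> by simp
  then have "N > 0 \<and> repunit_sum a k (N - 1) (S + m * s_sum k a)"
    using Suc.prems by (intro repunit_sum_greedy[OF \<open>a > 0\<close>]) (auto simp: algebra_simps)
  with Suc.IH[of "N - 1"] show ?case by auto
qed simp

section \<open>Reduced families\<close>

text \<open>The number represented by a family. The list entry at position 0 is the coefficient of
  \<open>s\<^sub>1\<close>.\<close>

definition repunit_value :: "nat \<Rightarrow> nat list \<Rightarrow> nat" where
  "repunit_value a js = (\<Sum>i = 1..length js. js ! (i - 1) * s_sum i a)"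

lemma represents_iff: "represents a js l \<longleftrightarrow> l = repunit_value a js"
  by (simp add: represents_def repunit_value_def)

text \<open>The conditions on an \<open>a\<close>-reduced family except \<open>j\<^sub>k \<noteq> 0\<close>. Unlike \<open>a\<close>-reducedness,
  they pass to initial segments.\<close>

definition weakly_reduced :: "nat \<Rightarrow> nat list \<Rightarrow> bool" where
  "weakly_reduced a js \<longleftrightarrow> (\<forall>m<length js. js ! m \<le> a \<and> (js ! m = a \<longrightarrow> (\<forall>i<m. js ! i = 0)))"

lemma a_reduced_iff: "a_reduced a js \<longleftrightarrow> weakly_reduced a js \<and> js \<noteq> [] \<and> last js \<noteq> 0"
proof -
  \<comment> \<open>Families are indexed from 1, lists from 0.\<close>
  have shift: "(\<forall>i\<in>{1..<Suc m}. P (i - 1)) \<longleftrightarrow> (\<forall>i<m. P i)" for P :: "nat \<Rightarrow> bool" and m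
  proof (intro iffI allI ballI impI)
    fix i assume "\<forall>i\<in>{1..<Suc m}. P (i - 1)" "i < m"
    then show "P i" using bspec[of "{1..<Suc m}" "\<lambda>i. P (i - 1)" "Suc i"] by simp
  next
    fix i assume "\<forall>i<m. P i" "i \<in> {1..<Suc m}"
    then show "P (i - 1)" by auto
  qed
  have shift': "(\<forall>i\<in>{1..n}. P (i - 1)) \<longleftrightarrow> (\<forall>i<n. P i)" for P :: "nat \<Rightarrow> bool" and n
    using shift[of n P] by (simp add: atLeastLessThanSuc_atLeastAtMost)
  have "(\<forall>m\<in>{1..length js}. js ! (m - 1) = a \<longrightarrow> (\<forall>i\<in>{1..<m}. js ! (i - 1) = 0)) \<longleftrightarrow>
      (\<forall>m\<in>{1..length js}. js ! (m - 1) = a \<longrightarrow> (\<forall>i\<in>{1..<Suc (m - 1)}. js ! (i - 1) = 0))"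
    by (intro ball_cong) auto
  also have "\<dots> \<longleftrightarrow> (\<forall>m<length js. js ! m = a \<longrightarrow> (\<forall>i<m. js ! i = 0))"
    unfolding shift[where P = "\<lambda>i. js ! i = 0"]
      shift'[where P = "\<lambda>m. js ! m = a \<longrightarrow> (\<forall>i<m. js ! i = 0)"] ..
  finally have zeros:
    "(\<forall>m\<in>{1..length js}. js ! (m - 1) = a \<longrightarrow> (\<forall>i\<in>{1..<m}. js ! (i - 1) = 0)) \<longleftrightarrow>
      (\<forall>m<length js. js ! m = a \<longrightarrow> (\<forall>i<m. js ! i = 0))" .
  have "length js \<ge> 1 \<and> js ! (length js - 1) \<noteq> 0 \<longleftrightarrow> js \<noteq> [] \<and> last js \<noteq> 0"
    by (cases "js = []") (simp_all add: last_conv_nth Suc_le_eq)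
  then show ?thesis
    unfolding a_reduced_def weakly_reduced_def zeros shift'[where P = "\<lambda>i. js ! i \<le> a"]
    by blast
qed

lemma weakly_reduced_snoc:
  "weakly_reduced a (js @ [j]) \<longleftrightarrow>
    weakly_reduced a js \<and> j \<le> a \<and> (j = a \<longrightarrow> (\<forall>i<length js. js ! i = 0))"
  by (auto simp: weakly_reduced_def nth_append less_Suc_eq)

lemma repunit_value_Nil [simp]: "repunit_value a [] = 0"
  by (simp add: repunit_value_def)

lemma sum_family_snoc:
  "(\<Sum>i = 1..length (js @ [j]). (js @ [j]) ! (i - 1) * f i) =
    (\<Sum>i = 1..length js. js ! (i - 1) * f i) + j * f (Suc (length js))"
  for f :: "nat \<Rightarrow> nat"
proof -
  have "(\<Sum>i = 1..length js. (js @ [j]) ! (i - 1) * f i) = (\<Sum>i = 1..length js. js ! (i - 1) * f i)"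
    by (intro sum.cong) (auto simp: nth_append)
  then show ?thesis by simp
qed

lemma repunit_value_snoc:
  "repunit_value a (js @ [j]) = repunit_value a js + j * s_sum (Suc (length js)) a"
  unfolding repunit_value_def by (rule sum_family_snoc)

lemma sum_family_affine:
  "(\<Sum>i = 1..length js. js ! (i - 1) * (c + s_sum i a * D)) =
    sum_list js * c + repunit_value a js * D"
proof (induction js rule: rev_induct)
  case (snoc j js)
  show ?case
    unfolding sum_family_snoc snoc repunit_value_snoc by (simp add: distrib_left distrib_right)
qed simp

lemma repunit_value_zeros: "\<forall>i<length js. js ! i = 0 \<Longrightarrow> repunit_value a js = 0"
  unfolding repunit_value_def by (intro sum.neutral) auto

lemma repunit_value_less:
  "weakly_reduced a js \<Longrightarrow> repunit_value a js < s_sum (Suc (length js)) a"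
proof (induction js rule: rev_induct)
  case Nil
  then show ?case by (simp add: s_sum_Suc)
next
  case (snoc j js)
  let ?s = "s_sum (Suc (length js)) a"
  have wr: "weakly_reduced a js" "j \<le> a" "j = a \<longrightarrow> (\<forall>i<length js. js ! i = 0)"
    using snoc.prems by (auto simp: weakly_reduced_snoc)
  have "repunit_value a js + j * ?s \<le> a * ?s"
  proof (cases "j = a")
    case True
    then show ?thesis using wr repunit_value_zeros by simp
  next
    case False
    then have "(j + 1) * ?s \<le> a * ?s" using wr(2) by (intro mult_le_mono1) simp
    then show ?thesis using snoc.IH[OF wr(1)] by simp
  qed
  then show ?case unfolding repunit_value_snoc length_append_singleton s_sum_Suc[of "Suc _"] by simp
qed

lemma weakly_reduced_unique:
  assumes "weakly_reduced a js" "weakly_reduced a ks" "length js = length ks"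
    "repunit_value a js = repunit_value a ks"
  shows "js = ks"
  using assms
proof (induction js arbitrary: ks rule: rev_induct)
  case (snoc j js)
  obtain ks' k where ks: "ks = ks' @ [k]" using snoc.prems(3) by (cases ks rule: rev_cases) auto
  let ?s = "s_sum (Suc (length js)) a"
  have len: "length ks' = length js" using snoc.prems(3) ks by simp
  have wr: "weakly_reduced a js" "weakly_reduced a ks'"
    using snoc.prems ks by (auto simp: weakly_reduced_snoc)
  have less: "repunit_value a js < ?s" "repunit_value a ks' < ?s"
    using repunit_value_less[OF wr(1)] repunit_value_less[OF wr(2)] len by auto
  have eq: "repunit_value a js + j * ?s = repunit_value a ks' + k * ?s"
    using snoc.prems(4) ks len by (simp add: repunit_value_snoc)
  \<comment> \<open>The last entry and the value of the rest are quotient and remainder modulo \<open>?s\<close>.\<close>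
  have "(repunit_value a js + j * ?s) div ?s = j" "(repunit_value a ks' + k * ?s) div ?s = k"
    using less by auto
  then have "j = k" using eq by simp
  then show ?case using snoc.IH[of ks'] wr len eq ks by simp
qed simp

lemma weakly_reduced_exists:
  "l < s_sum (Suc n) a \<Longrightarrow> \<exists>js. length js = n \<and> weakly_reduced a js \<and> repunit_value a js = l"
proof (induction n arbitrary: l)
  case 0
  then show ?case by (simp add: s_sum_Suc weakly_reduced_def)
next
  case (Suc n)
  let ?s = "s_sum (Suc n) a"
  have s: "?s > 0" by (simp add: s_sum_Suc)
  have le: "l \<le> a * ?s" using Suc.prems by (simp add: s_sum_Suc[of "Suc n"])
  obtain js where js: "length js = n" "weakly_reduced a js" "repunit_value a js = l mod ?s"
    using Suc.IH[of "l mod ?s"] s by auto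
  have "l div ?s \<le> a" using div_le_mono[OF le, of ?s] s by simp
  moreover have "js ! i = 0" if full: "l div ?s = a" and "i < length js" for i
  proof -
    have "a * ?s + l mod ?s = l" using full div_mult_mod_eq[of l ?s] by simp
    then have "repunit_value a js = 0" using js le by simp
    then show ?thesis using that s
      by (auto simp: repunit_value_def s_sum_Suc dest!: bspec[of _ _ "Suc i"])
  qed
  ultimately have "weakly_reduced a (js @ [l div ?s])"
    using js(2) by (simp add: weakly_reduced_snoc)
  moreover have "repunit_value a (js @ [l div ?s]) = l"
    unfolding repunit_value_snoc js(1,3) by (rule mod_div_mult_eq)
  ultimately show ?case using js(1) by (intro exI[of _ "js @ [l div ?s]"]) simp
qed

lemma a_reduced_value_ge:
  assumes "a_reduced a js"
  shows "s_sum (length js) a \<le> repunit_value a js"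
proof -
  have "js \<noteq> []" "last js \<noteq> 0" using assms by (auto simp: a_reduced_iff)
  then obtain ks j where "js = ks @ [j]" "j \<noteq> 0" by (cases js rule: rev_cases) auto
  then show ?thesis by (auto simp: repunit_value_snoc trans_le_add2)
qed

lemma ex1_a_reduced:
  assumes "a > 0" "l > 0"
  shows "\<exists>!js. a_reduced a js \<and> represents a js l"
proof -
  note mono = s_sum_strict_mono[OF \<open>a > 0\<close>]
  have ex: "\<exists>n. l < s_sum (Suc n) a"
    using strict_mono_imp_increasing[OF mono, of "Suc l"] by (intro exI[of _ l]) simp
  define n where "n = (LEAST n. l < s_sum (Suc n) a)"
  have n: "l < s_sum (Suc n) a" unfolding n_def using ex by (rule LeastI_ex)
  then obtain js where js: "length js = n" "weakly_reduced a js" "repunit_value a js = l"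
    using weakly_reduced_exists by blast
  have "a_reduced a js"
  proof -
    have "js \<noteq> []" using js(3) \<open>l > 0\<close> by auto
    moreover have "last js \<noteq> 0"
    proof
      assume "last js = 0"
      then have js': "js = butlast js @ [0]" using \<open>js \<noteq> []\<close> by (metis append_butlast_last_id)
      then have "weakly_reduced a (butlast js)" "repunit_value a (butlast js) = l"
        using js weakly_reduced_snoc[of a "butlast js" 0] repunit_value_snoc[of a "butlast js" 0]
        by auto
      then have "l < s_sum (Suc (n - 1)) a"
        using repunit_value_less[of a "butlast js"] js(1) by simp
      then have "n \<le> n - 1" unfolding n_def by (rule Least_le)
      then show False using \<open>js \<noteq> []\<close> js(1) by (cases n) auto
    qed
    ultimately show ?thesis using js(2) by (simp add: a_reduced_iff)
  qed
  moreover have "ks = js" if ks: "a_reduced a ks" "represents a ks l" for ks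
  proof -
    have le: "length u \<le> length v" if uv: "a_reduced a u" "a_reduced a v"
      and eq: "repunit_value a u = repunit_value a v" for u v
    proof -
      have "s_sum (length u) a < s_sum (Suc (length v)) a"
        using a_reduced_value_ge[OF uv(1)] repunit_value_less[of a v] uv(2) eq
        by (simp add: a_reduced_iff)
      then show ?thesis using strict_mono_less[OF mono] by simp
    qed
    have "repunit_value a ks = repunit_value a js" using ks js by (simp add: represents_iff)
    moreover from this have "length ks = length js"
      using le ks(1) \<open>a_reduced a js\<close> by (metis le_antisym)
    ultimately show ?thesis
      using weakly_reduced_unique ks(1) js(2) by (auto simp: a_reduced_iff)
  qed
  ultimately show ?thesis using js(3) by (auto simp: represents_iff)
qed

lemma repunit_sum_family: "repunit_sum a (length js) (sum_list js) (repunit_value a js)"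
proof (induction js rule: rev_induct)
  case (snoc j js)
  have "repunit_sum a (Suc (length js)) (j * 1) (j * s_sum (Suc (length js)) a)"
    by (intro repunit_sum_mult repunit_sum_single) simp
  from repunit_sum_add[OF this repunit_sum_mono[OF snoc, of "Suc (length js)"]]
  show ?case by (simp add: repunit_value_snoc)
qed (simp add: repunit_sum.zero)

text \<open>Weakly reduced families use the fewest terms: their last entry \<open>j\<close> counts the greedy steps that
  remove the largest repunit, and each of them lowers \<open>N\<close> by one.\<close>

lemma weakly_reduced_minimal:
  assumes "a > 0" "weakly_reduced a js" "repunit_sum a k N (repunit_value a js)"
  shows "sum_list js \<le> N"
  using assms(2,3)
proof (induction js arbitrary: k N rule: rev_induct)
  case (snoc j js)
  let ?n = "Suc (length js)"
  have "repunit_sum a ?n N (repunit_value a js + j * s_sum ?n a)"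
    using repunit_sum_bound_index[OF snoc.prems(2)] repunit_value_less[OF snoc.prems(1)] \<open>a > 0\<close>
    by (simp add: repunit_value_snoc)
  then have "j \<le> N \<and> repunit_sum a ?n (N - j) (repunit_value a js)"
    using \<open>a > 0\<close> by (intro repunit_sum_greedy_iter) auto
  moreover from this have "sum_list js \<le> N - j"
    using snoc.IH snoc.prems(1) by (auto simp: weakly_reduced_snoc)
  ultimately show ?case by auto
qed simp

section \<open>The semigroup and its smallest elements in residue classes\<close>

text \<open>The condition \<open>c > 0\<close> is needed: \<open>\<theta>\<close> is applied to nonzero elements only, so the semigroup
  generated by 0 is trivial, while the right-hand side contains \<open>b\<close>.\<close>

lemma theta_gen_eq:
  assumes "a > 0" "c > 0"
  shows "theta_gen a b c = {N * c + S * ((a - 1) * c + b) | N S. \<exists>k. repunit_sum a k N S}"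
    (is "_ = ?H")
proof
  let ?D = "(a - 1) * c + b"
  have HI: "N * c + S * ?D \<in> ?H" if "repunit_sum a k N S" for k N S
    using that by blast
  have plus: "x + y \<in> ?H" if xy: "x \<in> ?H" "y \<in> ?H" for x y
  proof -
    obtain k N S k' N' S' where x: "x = N * c + S * ?D" "repunit_sum a k N S"
      and y: "y = N' * c + S' * ?D" "repunit_sum a k' N' S'" using xy by blast
    have "repunit_sum a (max k k') (N' + N) (S' + S)"
      by (intro repunit_sum_add repunit_sum_mono[OF x(2)] repunit_sum_mono[OF y(2)]) auto
    from HI[OF this] show ?thesis unfolding x(1) y(1) distrib_right by (simp only: ac_simps)
  qed
  have t: "c + s_sum k a * ?D \<in> ?H" for k
    using HI[OF repunit_sum_single[of k k a]] by simp
  have theta: "theta a b x \<in> ?H" if xH: "x \<in> ?H" "x \<noteq> 0" for x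
  proof -
    obtain k N S where x: "x = N * c + S * ?D" and r: "repunit_sum a k N S"
      using xH(1) by blast
    from r show ?thesis
    proof cases
      case zero
      then show ?thesis using x xH by simp
    next
      case (add M R i)
      \<comment> \<open>With one generator split off, \<open>\<theta>(t\<^sub>i + z) = t\<^sub>i\<^sub>+\<^sub>1 + a z\<close>.\<close>
      have "theta a b x = (c + s_sum (Suc i) a * ?D) + ((a * M) * c + (a * R) * ?D)"
      proof -
        obtain d where "a = Suc d" using assms gr0_implies_Suc by blast
        then show ?thesis by (simp add: x add theta_def s_sum_Suc algebra_simps)
      qed
      then show ?thesis using plus[OF t HI[OF repunit_sum_mult[OF add(3)]]] by simp
    qed
  qed
  have "theta_semigroup a b ?H"
    unfolding theta_semigroup_def subsemigroup0_def
    using plus theta HI[OF repunit_sum.zero] by auto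
  moreover have "c \<in> ?H" using t[of 0] by simp
  ultimately show "theta_gen a b c \<subseteq> ?H" by (rule theta_gen_least(3))
next
  let ?D = "(a - 1) * c + b"
  have sg: "0 \<in> theta_gen a b c"
      "\<And>x y. x \<in> theta_gen a b c \<Longrightarrow> y \<in> theta_gen a b c \<Longrightarrow> x + y \<in> theta_gen a b c"
      "\<And>x. x \<in> theta_gen a b c \<Longrightarrow> x \<noteq> 0 \<Longrightarrow> theta a b x \<in> theta_gen a b c"
    using theta_gen_least(1)[of a b c] by (auto simp: theta_semigroup_def subsemigroup0_def)
  have t: "c + s_sum k a * ?D \<in> theta_gen a b c" for k
  proof (induction k)
    case 0
    then show ?case using theta_gen_least(2) by simp
  next
    case (Suc k)
    have "theta a b (c + s_sum k a * ?D) = c + s_sum (Suc k) a * ?D"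
    proof -
      obtain d where "a = Suc d" using assms gr0_implies_Suc by blast
      then show ?thesis by (simp add: theta_def s_sum_Suc algebra_simps)
    qed
    then show ?case using sg(3)[OF Suc] assms by simp
  qed
  have "N * c + S * ?D \<in> theta_gen a b c" if "repunit_sum a k N S" for k N S
    using that
  proof (induction rule: repunit_sum.induct)
    case (add N S i)
    then show ?case using sg(2)[OF add.IH t[of i]] by (simp add: algebra_simps)
  qed (simp add: sg)
  then show "?H \<subseteq> theta_gen a b c" by blast
qed

lemma coprime_cong_exhaust:
  fixes b c n :: nat
  assumes "coprime b c" "c > 0"
  shows "\<exists>l<c. [n = b * l] (mod c)"
proof -
  obtain w where w: "[b * w = 1] (mod c)" using assms(1) cong_solve_coprime_nat by auto
  have "[b * (w * n mod c) = b * w * n] (mod c)"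
    by (simp add: cong_def mod_mult_right_eq mult.assoc)
  also have "[b * w * n = 1 * n] (mod c)" using w by (rule cong_mult) simp
  finally show ?thesis using \<open>c > 0\<close> by (intro exI[of _ "w * n mod c"]) (simp add: cong_sym)
qed

lemma coprime_cong_inj:
  fixes b c l m :: nat
  assumes "coprime b c" "l < c" "m < c" "[b * l = b * m] (mod c)"
  shows "l = m"
proof -
  have "[l = m] (mod c)" using cong_mult_lcancel_nat[OF assms(1)] assms(4) by blast
  then show ?thesis using assms(2,3) by (simp add: cong_def)
qed

lemma cong_less_imp_add_le:
  fixes x y c :: nat
  assumes "[x = y] (mod c)" "x < y"
  shows "x + c \<le> y"
proof -
  have "c dvd y - x"
    using assms mod_eq_dvd_iff_nat[of x y c] by (simp add: cong_def)
  then have "c \<le> y - x" using assms(2) by (intro dvd_imp_le) auto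
  then show ?thesis using assms(2) by simp
qed

text \<open>Here \<open>w\<close> is the sum of the entries of the reduced family of \<open>l\<close>, the least number of
  repunits with sum \<open>l\<close>.\<close>

lemma x_elem_eq:
  assumes "a > 0"
  obtains w k where "x_elem a b c l = w * c + l * ((a - 1) * c + b)" "repunit_sum a k w l"
    "\<And>k N. repunit_sum a k N l \<Longrightarrow> w \<le> N"
proof (cases "l = 0")
  case True
  then have "x_elem a b c l = 0 * c + l * ((a - 1) * c + b)" "repunit_sum a 0 0 l"
    by (simp_all add: x_elem_def repunit_sum.zero)
  then show ?thesis by (rule that) simp
next
  case False
  define js where "js = reduced_family a l"
  have js: "a_reduced a js \<and> represents a js l"
    unfolding js_def reduced_family_def using False
    by (intro theI'[OF ex1_a_reduced[OF assms]]) simp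
  then have red: "weakly_reduced a js" and val: "repunit_value a js = l"
    by (auto simp: a_reduced_iff represents_iff)
  have "x_elem a b c l = (\<Sum>i = 1..length js. js ! (i - 1) * t_term i a b c)"
    using False by (simp add: x_elem_def js_def Let_def)
  also have "\<dots> = sum_list js * c + repunit_value a js * ((a - 1) * c + b)"
    unfolding t_term_eq[OF assms] by (rule sum_family_affine)
  finally show ?thesis
    using that[of "sum_list js" "length js"] repunit_sum_family[of a js]
      weakly_reduced_minimal[OF assms red]
    unfolding val by blast
qed

lemma x_elem_cong:
  assumes "a > 0"
  shows "[x_elem a b c l = b * l] (mod c)"
proof -
  obtain w where "x_elem a b c l = w * c + l * ((a - 1) * c + b)" using x_elem_eq[OF assms] by blast
  then have "x_elem a b c l = b * l + (w + l * (a - 1)) * c"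
    by (simp only: distrib_right distrib_left ac_simps)
  then show ?thesis by (simp add: cong_def)
qed

lemma x_elem_less_Suc:
  assumes "a > 0" "b > 0"
  shows "x_elem a b c l < x_elem a b c (Suc l)"
proof -
  let ?D = "(a - 1) * c + b"
  obtain w where w: "x_elem a b c l = w * c + l * ?D" "\<And>k N. repunit_sum a k N l \<Longrightarrow> w \<le> N"
    by (rule x_elem_eq[OF assms(1), of b c l]) blast
  obtain v k where v: "x_elem a b c (Suc l) = v * c + Suc l * ?D" "repunit_sum a k v (Suc l)"
    by (rule x_elem_eq[OF assms(1), of b c "Suc l"]) blast
  have "w \<le> v + (a - 1)" using w(2) repunit_sum_pred[OF v(2)] assms(1) by simp
  then have "w * c \<le> v * c + (a - 1) * c" unfolding distrib_right[symmetric] by (rule mult_le_mono1)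
  then show ?thesis using w(1) v(1) assms(2) by simp
qed

lemma x_elem_strict_mono:
  "a > 0 \<Longrightarrow> b > 0 \<Longrightarrow> strict_mono (x_elem a b c)"
  by (simp add: strict_mono_Suc_iff x_elem_less_Suc)

text \<open>An element of the semigroup has the form \<open>N c + S D\<close> with \<open>D = (a - 1) c + b\<close> and \<open>S\<close> a
  sum of \<open>N\<close> repunits. If it lies in the class of \<open>b l\<close>, then \<open>S = l + q c\<close>; lowering \<open>S\<close> to \<open>l\<close>
  costs at most \<open>q c (a - 1)\<close> terms, whose contribution \<open>q c (a - 1) c\<close> does not exceed the gain
  \<open>q c D\<close>.\<close>

lemma mem_theta_gen_iff:
  assumes "a > 0" "coprime b c" "l < c" "[n = b * l] (mod c)"
  shows "n \<in> theta_gen a b c \<longleftrightarrow> x_elem a b c l \<le> n"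
proof -
  let ?D = "(a - 1) * c + b"
  have "c > 0" using assms(3) by simp
  obtain w k where w: "x_elem a b c l = w * c + l * ?D" "repunit_sum a k w l"
    "\<And>k N. repunit_sum a k N l \<Longrightarrow> w \<le> N"
    by (rule x_elem_eq[OF assms(1), of b c l]) blast
  show ?thesis
  proof
    assume "n \<in> theta_gen a b c"
    then obtain k N S where n: "n = N * c + S * ?D" and r: "repunit_sum a k N S"
      using theta_gen_eq[OF assms(1) \<open>c > 0\<close>] by auto
    have "n = b * S + (N + S * (a - 1)) * c"
      using n by (simp only: distrib_right distrib_left ac_simps)
    then have "[b * S = n] (mod c)" by (simp add: cong_def)
    then have "[b * S = b * l] (mod c)" using assms(4) by (rule cong_trans)
    then have "[S = l] (mod c)"
      using cong_mult_lcancel_nat[OF assms(2)] by blast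
    then have "S mod c = l" using assms(3) by (simp add: cong_def)
    then obtain q where S: "S = l + q * c" by (metis mod_div_decomp add.commute)
    have "w \<le> N + q * c * (a - 1)"
      using w(3) repunit_sum_diff r S assms(1) by blast
    then have "w * c \<le> N * c + q * c * ((a - 1) * c)"
      unfolding mult.assoc[symmetric] distrib_right[symmetric] by (rule mult_le_mono1)
    also have "\<dots> \<le> N * c + q * c * ?D" by simp
    finally show "x_elem a b c l \<le> n" unfolding w(1) n S by (simp add: distrib_right)
  next
    assume le: "x_elem a b c l \<le> n"
    have "[n = x_elem a b c l] (mod c)"
      using assms(4) x_elem_cong[OF assms(1), of b c l] by (metis cong_sym cong_trans)
    then obtain q where q: "n = x_elem a b c l + q * c"
      using le cong_le_nat by (metis add.commute)
    have "n = (w + q) * c + l * ?D" using q w(1) by (simp add: distrib_right)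
    moreover have "repunit_sum a k (w + q) l" using w(2) by (rule repunit_sum_pad) simp
    ultimately show "n \<in> theta_gen a b c"
      unfolding theta_gen_eq[OF assms(1) \<open>c > 0\<close>] by blast
  qed
qed

section \<open>Genus and smallest elements of residue classes\<close>

lemma card_cong_less:
  assumes "c > 0"
  shows "card {n::nat. n < x \<and> [n = x] (mod c)} = x div c"
proof -
  let ?f = "\<lambda>m. x - Suc m * c"
  have le: "Suc m * c \<le> x" if "m < x div c" for m
  proof -
    have "Suc m * c \<le> x div c * c" using that by (intro mult_le_mono1) simp
    also have "\<dots> \<le> x" by simp
    finally show ?thesis .
  qed
  have "{n. n < x \<and> [n = x] (mod c)} = ?f ` {..<x div c}" (is "?A = ?B")
  proof (intro set_eqI iffI)
    fix n assume n: "n \<in> ?A"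
    then obtain q where q: "x = n + q * c" using cong_le_nat[of n x c] by (auto simp: cong_sym_eq)
    then have "q > 0" using n by (cases q) auto
    moreover have "q \<le> x div c" using q assms by simp
    ultimately show "n \<in> ?B" using q by (intro image_eqI[of _ _ "q - 1"]) auto
  next
    fix n assume "n \<in> ?B"
    then obtain m where m: "m < x div c" "n = x - Suc m * c" by blast
    then have "x = n + Suc m * c" using le[OF m(1)] by simp
    then show "n \<in> ?A" using assms by (auto simp: cong_def simp flip: mult_Suc)
  qed
  moreover have "inj_on ?f {..<x div c}"
  proof (rule inj_onI)
    fix m m' assume m: "m \<in> {..<x div c}" "m' \<in> {..<x div c}" "?f m = ?f m'"
    then have "Suc m * c = Suc m' * c"
      using le[of m] le[of m'] by (metis diff_diff_cancel lessThan_iff)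
    then show "m = m'" using assms by simp
  qed
  ultimately show ?thesis by (simp add: card_image)
qed

text \<open>Selmer's formula: if the elements of \<open>G\<close> in the class of \<open>b l\<close> modulo \<open>c\<close> are exactly those
  from \<open>x l\<close> onwards, then each class has \<open>x l div c\<close> gaps, and the remainders \<open>x l mod c\<close> run
  through \<open>0, \<dots>, c - 1\<close>.\<close>

lemma genus_residue_minima:
  assumes "coprime b c" "c > 0"
    and x: "\<And>l. l < c \<Longrightarrow> [x l = b * l] (mod c)"
    and mem: "\<And>l n. l < c \<Longrightarrow> [n = b * l] (mod c) \<Longrightarrow> n \<in> G \<longleftrightarrow> x l \<le> n"
  shows "2 * (c * genus G) + c * (c - 1) = 2 * (\<Sum>l<c. x l)"
proof -
  let ?A = "\<lambda>l. {n. n < x l \<and> [n = x l] (mod c)}"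
  have "- G = (\<Union>l<c. ?A l)"
  proof (intro set_eqI iffI)
    fix n assume "n \<in> - G"
    moreover obtain l where l: "l < c" "[n = b * l] (mod c)"
      using coprime_cong_exhaust[OF assms(1,2)] by blast
    ultimately have "n < x l" using mem by auto
    moreover have "[n = x l] (mod c)" using l x by (metis cong_sym cong_trans)
    ultimately show "n \<in> (\<Union>l<c. ?A l)" using l(1) by blast
  next
    fix n assume "n \<in> (\<Union>l<c. ?A l)"
    then obtain l where "l < c" "n < x l" "[n = x l] (mod c)" by blast
    then show "n \<in> - G" using mem x by (metis ComplI cong_trans not_le)
  qed
  moreover have "?A l \<inter> ?A m = {}" if "l < c" "m < c" "l \<noteq> m" for l m
  proof -
    have "\<not> [x l = x m] (mod c)"
      using coprime_cong_inj[OF assms(1) that(1,2)] x that by (metis cong_sym cong_trans)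
    then show ?thesis by (auto simp: cong_def)
  qed
  ultimately have "genus G = (\<Sum>l<c. card (?A l))"
    unfolding genus_def by (simp, intro card_UN_disjoint) auto
  then have genus: "genus G = (\<Sum>l<c. x l div c)" by (simp add: card_cong_less[OF assms(2)])
  have inj: "inj_on (\<lambda>l. x l mod c) {..<c}"
  proof (rule inj_onI)
    fix l m assume lm: "l \<in> {..<c}" "m \<in> {..<c}" "x l mod c = x m mod c"
    then have "[b * l = b * m] (mod c)" using x by (simp add: cong_def)
    then show "l = m" using coprime_cong_inj[OF assms(1)] lm by simp
  qed
  have "(\<lambda>l. x l mod c) ` {..<c} = {..<c}"
    by (rule endo_inj_surj[OF _ _ inj]) (use assms(2) in auto)
  then have "(\<Sum>l<c. x l mod c) = (\<Sum>l<c. l)"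
    using sum.reindex[OF inj, of "\<lambda>i. i"] by simp
  then have rem: "2 * (\<Sum>l<c. x l mod c) = c * (c - 1)"
    using gauss_sum_nat[of "c - 1"] assms(2) Sum_Ico_nat[of 0 c]
    by (simp add: lessThan_atLeast0)
  have "(\<Sum>l<c. x l) = (\<Sum>l<c. c * (x l div c) + x l mod c)" by simp
  also have "\<dots> = c * genus G + (\<Sum>l<c. x l mod c)"
    by (simp only: sum.distrib genus sum_distrib_left)
  finally show ?thesis using rem by simp
qed

theorem theorem3p4:
  fixes a b c :: nat
  assumes "a > 0" and "b > 0" and "c \<ge> 2" and "gcd b c = 1"
  shows "(\<forall>l\<in>{1..c - 1}. \<exists>!js. a_reduced a js \<and> represents a js l) \<and>
    (\<forall>l\<in>{0..c - 1}. x_elem a b c l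
        = (LEAST n. n \<in> theta_gen a b c \<and> [n = b * l] (mod c))) \<and>
    apery (theta_gen a b c) c = {x_elem a b c l |l. l \<in> {0..c - 1}} \<and>
    frobenius (theta_gen a b c) = int (x_elem a b c (c - 1)) - int c \<and>
    real (genus (theta_gen a b c))
        = 1 / real c * (\<Sum>l = 1..c - 1. real (x_elem a b c l)) - (real c - 1) / 2"
proof -
  let ?G = "theta_gen a b c" and ?x = "x_elem a b c"
  have cop: "coprime b c" and "c > 0" using assms by (auto simp: coprime_iff_gcd_eq_1)
  note mem = mem_theta_gen_iff[OF \<open>a > 0\<close> cop]
  note x_cong = x_elem_cong[OF \<open>a > 0\<close>, of b c]
  have residue: "\<exists>l<c. [n = b * l] (mod c)" for n
    using coprime_cong_exhaust[OF cop \<open>c > 0\<close>] .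
  have range: "{0..c - 1} = {..<c}" using \<open>c > 0\<close> by auto
  have x_in: "?x l \<in> ?G" if "l < c" for l
    using mem[OF that x_cong] by simp
  have x_diff: "int (?x l) - int c \<notin> int ` ?G" if "l < c" for l
  proof
    assume "int (?x l) - int c \<in> int ` ?G"
    then obtain n where n: "n \<in> ?G" "int (?x l) - int c = int n" by blast
    then have xn: "?x l = n + c" by linarith
    then have "[n = b * l] (mod c)" using x_cong[of l] by (simp add: cong_def)
    from mem[OF that this] show False using n xn \<open>c > 0\<close> by simp
  qed
  have reduced: "\<forall>l\<in>{1..c - 1}. \<exists>!js. a_reduced a js \<and> represents a js l"
    using ex1_a_reduced[OF \<open>a > 0\<close>] by simp
  have least: "\<forall>l\<in>{0..c - 1}. ?x l = (LEAST n. n \<in> ?G \<and> [n = b * l] (mod c))"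
  proof
    fix l assume "l \<in> {0..c - 1}"
    then have "l < c" using \<open>c > 0\<close> by auto
    then show "?x l = (LEAST n. n \<in> ?G \<and> [n = b * l] (mod c))"
      using mem x_in x_cong by (intro Least_equality[symmetric]) auto
  qed
  have apery_image: "apery ?G c = ?x ` {..<c}"
  proof (intro set_eqI iffI)
    fix u assume "u \<in> apery ?G c"
    then have u: "u \<in> ?G" "int u - int c \<notin> int ` ?G" by (auto simp: apery_def)
    obtain l where l: "l < c" "[u = b * l] (mod c)" using residue by blast
    have le: "?x l \<le> u" using mem[OF l] u(1) by simp
    have "?x l = u"
    proof (rule ccontr)
      assume "?x l \<noteq> u"
      moreover have "[?x l = u] (mod c)" using l(2) x_cong by (metis cong_sym cong_trans)
      ultimately have ge: "?x l + c \<le> u" using le by (intro cong_less_imp_add_le) auto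
      have "[u - c = b * l] (mod c)" using l(2) ge by (simp add: cong_def le_mod_geq)
      then have "u - c \<in> ?G" using mem[OF l(1)] ge by simp
      moreover have "int u - int c = int (u - c)" using ge by simp
      ultimately show False using u(2) by (metis imageI)
    qed
    then show "u \<in> ?x ` {..<c}" using l(1) by blast
  next
    fix u assume "u \<in> ?x ` {..<c}"
    then obtain l where "l < c" "u = ?x l" by blast
    then show "u \<in> apery ?G c" using x_in x_diff by (simp add: apery_def)
  qed
  have apery: "apery ?G c = {?x l |l. l \<in> {0..c - 1}}"
    unfolding Setcompr_eq_image range by (rule apery_image)
  have frobenius: "frobenius ?G = int (?x (c - 1)) - int c"
    unfolding frobenius_def
  proof (rule Greatest_equality)
    show "int (?x (c - 1)) - int c \<notin> int ` ?G" using x_diff \<open>c > 0\<close> by simp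
  next
    fix z assume z: "z \<notin> int ` ?G"
    show "z \<le> int (?x (c - 1)) - int c"
    proof (cases "z < 0")
      case True
      \<comment> \<open>The element \<open>x\<^sub>c\<^sub>-\<^sub>1\<close> is a sum of at least one generator, so it is at least \<open>c\<close>.\<close>
      obtain w k where w: "?x (c - 1) = w * c + (c - 1) * ((a - 1) * c + b)"
        "repunit_sum a k w (c - 1)"
        by (rule x_elem_eq[OF assms(1), of b c "c - 1"]) blast
      from w(2) have "w > 0" using assms(3) by cases auto
      then have "c \<le> w * c" by simp
      then have "c \<le> ?x (c - 1)" unfolding w(1) by (rule trans_le_add1)
      then show ?thesis using True by linarith
    next
      case False
      then obtain n where n: "z = int n" using nonneg_int_cases by (metis not_less)
      then have "n \<notin> ?G" using z by blast
      obtain l where l: "l < c" "[n = b * l] (mod c)" using residue by blast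
      then have "n < ?x l" using mem \<open>n \<notin> ?G\<close> by simp
      moreover have "[n = ?x l] (mod c)" using l(2) x_cong by (metis cong_sym cong_trans)
      ultimately have "n + c \<le> ?x l" by (intro cong_less_imp_add_le)
      also have "?x l \<le> ?x (c - 1)"
        using strict_mono_less_eq[OF x_elem_strict_mono[OF assms(1,2)], of c l "c - 1"] l(1) by simp
      finally show ?thesis using n by linarith
    qed
  qed
  have genus: "real (genus ?G)
      = 1 / real c * (\<Sum>l = 1..c - 1. real (?x l)) - (real c - 1) / 2"
  proof -
    have "{..<c} = insert 0 {1..c - 1}" using \<open>c > 0\<close> by auto
    then have "(\<Sum>l<c. ?x l) = (\<Sum>l = 1..c - 1. ?x l)" by (simp add: x_elem_def)
    then have "2 * (c * genus ?G) + c * (c - 1) = 2 * (\<Sum>l = 1..c - 1. ?x l)"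
      using genus_residue_minima[OF cop \<open>c > 0\<close>, of ?x ?G] x_cong mem by simp
    then have "real (2 * (c * genus ?G) + c * (c - 1)) = real (2 * (\<Sum>l = 1..c - 1. ?x l))"
      by (rule arg_cong)
    then have "2 * (real c * real (genus ?G)) + real c * (real c - 1)
        = 2 * (\<Sum>l = 1..c - 1. real (?x l))"
      using \<open>c > 0\<close> by (simp add: of_nat_diff)
    then show ?thesis using \<open>c > 0\<close> by (simp add: field_simps)
  qed
  show ?thesis by (intro conjI reduced least apery frobenius genus)
qed

end
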